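(* Let $G$ be a finite path graph. Then for every starting vertex $v$ of $G$ the Explorer has a nonadaptive strategy that visits each vertex exactly once, regardless of the Director's choices; that is, there is a finite sequence $S$ of distances such that, when the Explorer calls the entries of $S$ in order starting with the token at $v$, for every possible play of the Director the token occupies each vertex of $G$ exactly once (counting the initial position $v$).
   Context: Explorer-Director game on a connected graph $G$ with starting vertex $v$: a token is initially at $v$ (so $v$ counts as visited). On each turn the Explorer names a distance $d$ such that at least one vertex of $G$ is at (shortest-path) distance exactly $d$ from the token's current position, and then the Director moves the token to a vertex of their choice at distance exactly $d$ from the current position. A nonadaptive strategy is a finite sequence of natural numbers, fixed in advance, which the Explorer calls in order regardless of the Director's choices (each call must be a legal move whatever the Director has done before). *)

theory Defs
  imports "Graph_Theory.Graph_Theory"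
begin

definition path_graph :: "('a, 'b) pre_digraph \<Rightarrow> bool" where
  "path_graph G \<longleftrightarrow> graph G \<and>
     (\<exists>xs. xs \<noteq> [] \<and> distinct xs \<and> set xs = verts G \<and>
        (\<forall>i<length xs. \<forall>j<length xs.
           xs ! i \<rightarrow>\<^bsub>G\<^esub> xs ! j \<longleftrightarrow> j = Suc i \<or> i = Suc j))"

(* Shortest-path distance is the infimum of walk costs under unit weights. It is infinite unless
   u and w are both vertices, so at_distance only relates vertices of G. *)
definition at_distance :: "('a, 'b) pre_digraph \<Rightarrow> nat \<Rightarrow> 'a \<Rightarrow> 'a \<Rightarrow> bool" where
  "at_distance G d u w \<longleftrightarrow> wf_digraph.\<mu> G (\<lambda>_. 1) u w = ereal (real d)"

(* play G v S ps: with the token starting at v, some choices of the Director in answer to the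
   calls S produce the sequence ps of token positions, the initial position v included. *)
inductive play :: "('a, 'b) pre_digraph \<Rightarrow> 'a \<Rightarrow> nat list \<Rightarrow> 'a list \<Rightarrow> bool"
  for G where
  play_Nil: "play G v [] [v]"
| play_Cons: "\<lbrakk>at_distance G d v w; play G w S ps\<rbrakk> \<Longrightarrow> play G v (d # S) (v # ps)"

definition nonadaptive_strategy :: "('a, 'b) pre_digraph \<Rightarrow> 'a \<Rightarrow> nat list \<Rightarrow> bool" where
  "nonadaptive_strategy G v S \<longleftrightarrow>
     (\<forall>i<length S. \<forall>ps. play G v (take i S) ps \<longrightarrow> (\<exists>w. at_distance G (S ! i) (last ps) w))"

definition visits_each_vertex_once :: "('a, 'b) pre_digraph \<Rightarrow> 'a \<Rightarrow> nat list \<Rightarrow> bool" where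
  "visits_each_vertex_once G v S \<longleftrightarrow>
     (\<forall>ps. play G v S ps \<longrightarrow> (\<forall>x\<in>verts G. count_list ps x = 1))"

end

(* Call a move from i to j on {0..<n} forced if the mirror image 2i - j of the target falls outside
   the path, so that the Director has no choice when the Explorer calls the distance |i - j|.
   A Hamiltonian path of forced moves starting at v yields the strategy at once.  Such paths
   are zigzags between the lower and the upper half of the path, rearranged so that v comes first;
   by reflection v may be assumed to lie in the lower half.  Only the centre of a path of odd order
   is the source of no forced move.  If v is not the centre, the centre comes last; if it is,
   the first call sends the token to one of the two ends, and mirror-symmetric plays of the same calls
   follow. *)

theory Submission
  imports Defs
begin

section \<open>Zigzags and Hamiltonian paths of forced moves\<close>

section \<open>Forced moves\<close>

definition forced :: "nat \<Rightarrow> nat \<Rightarrow> nat \<Rightarrow> bool" where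
  "forced n i j \<longleftrightarrow> i < n \<and> j < n \<and> (2 * i < j \<or> n + j \<le> 2 * i)"

text \<open>With a constant offset \<open>c\<close>, forcedness of a whole zigzag reduces to two
  linear inequalities: one for the step up from \<open>j\<close> to \<open>j + c\<close>, one for
  the step from \<open>j + c\<close> down to the next entry of \<open>js\<close>.\<close>

definition zigzag :: "nat \<Rightarrow> nat list \<Rightarrow> nat list" where
  "zigzag c js = concat (map (\<lambda>j. [j, j + c]) js)"

lemma zigzag_simps [simp]:
  "zigzag c [] = []"
  "zigzag c (j # js) = j # (j + c) # zigzag c js"
  by (simp_all add: zigzag_def)

lemma zigzag_eq_Nil [simp]: "zigzag c js = [] \<longleftrightarrow> js = []"
  by (cases js) auto

lemma set_zigzag: "set (zigzag c js) = set js \<union> (\<lambda>j. j + c) ` set js"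
  by (induction js) auto

lemma set_zigzag_upt [simp]:
  "set (zigzag c [a..<b]) = {a..<b} \<union> {a + c..<b + c}"
  "set (zigzag c (rev [a..<b])) = {a..<b} \<union> {a + c..<b + c}"
  by (simp_all only: set_zigzag set_rev set_upt image_add_atLeastLessThan')

lemma length_zigzag [simp]: "length (zigzag c js) = 2 * length js"
  by (induction js) auto

lemma hd_zigzag [simp]: "js \<noteq> [] \<Longrightarrow> hd (zigzag c js) = hd js"
  by (cases js) auto

lemma last_zigzag [simp]: "js \<noteq> [] \<Longrightarrow> last (zigzag c js) = last js + c"
  by (induction js) auto

lemma successively_zigzag [simp]:
  "successively P (zigzag c js) \<longleftrightarrow>
     (\<forall>j\<in>set js. P j (j + c)) \<and> successively (\<lambda>i j. P (i + c) j) js"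
  by (induction js) (auto simp: successively_Cons)

lemma successively_upt [simp]:
  "successively P [a..<b] \<longleftrightarrow> (\<forall>i. a \<le> i \<and> Suc i < b \<longrightarrow> P i (Suc i))"
proof (induction b)
  case (Suc b)
  then show ?case
    by (cases b) (auto simp: successively_append_iff less_Suc_eq)
qed simp

lemma last_rev_upt [simp]: "a < b \<Longrightarrow> last (rev [a..<b]) = a"
  by (simp add: last_rev)

lemma hd_rev_upt [simp]: "a < b \<Longrightarrow> hd (rev [a..<b]) = b - 1"
  by (simp add: hd_rev)

lemma forced_path_even:
  assumes "v < m"
  shows "\<exists>L. L \<noteq> [] \<and> hd L = v \<and> successively (forced (2 * m)) L \<and>
             set L = {..<2 * m} \<and> length L = 2 * m"
proof -
  consider "v = m - 1" | "m = 2" "v = 0" | "m \<ge> 3" "v \<le> m - 2"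
    using assms by linarith
  then show ?thesis
  proof cases
    case 1
    \<comment> \<open>The order is m - 1, 2m - 1, m - 2, 2m - 2, ..., 0, m.\<close>
    let ?L = "zigzag m (rev [0..<m])"
    have "set ?L = {..<2 * m}"
    proof (intro set_eqI)
      fix x
      show "x \<in> set ?L \<longleftrightarrow> x \<in> {..<2 * m}"
        by auto
    qed
    then show ?thesis
      using assms 1 by (intro exI[of _ ?L]) (auto simp: forced_def)
  next
    case 2
    then show ?thesis
      \<comment> \<open>The pattern of the third case fails here: its move from 2m - 2 to m - 1 is
        forced only for m \<ge> 3.\<close>
      by (intro exI[of _ "[0, 1, 3, 2]"]) (auto simp: forced_def)
  next
    case 3
    \<comment> \<open>Since v and 2m - 2 are spent at the start, the lower entries between v and m -
      1 take partners one smaller than in the plain zigzag. Below v the offset \<open>m\<close> is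
      available again.\<close>
    let ?A = "zigzag (m - 1) (rev [Suc v..<m - 1])" and ?B = "zigzag m (rev [0..<v])"
    let ?L = "[v, 2 * m - 2, m - 1, 2 * m - 1] @ ?A @ ?B"
    have "successively (forced (2 * m)) ?L"
      using 3 by (auto simp: successively_append_iff successively_Cons forced_def hd_append)
    moreover have "set ?L = {..<2 * m}"
    proof (intro set_eqI)
      fix x
      show "x \<in> set ?L \<longleftrightarrow> x \<in> {..<2 * m}"
        using 3 by auto
    qed
    moreover have "length ?L = 2 * m"
      using 3 by auto
    ultimately show ?thesis
      by (intro exI[of _ ?L]) auto
  qed
qed

lemma forced_path_odd:
  assumes "v < m"
  shows "\<exists>L. L \<noteq> [] \<and> hd L = v \<and> successively (forced (2 * m + 1)) L \<and>
             set L = {..<2 * m + 1} \<and> length L = 2 * m + 1"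
proof (cases "v = 0")
  case True
  \<comment> \<open>The order is 0, m + 1, 1, m + 2, ..., m - 1, 2m, and finally the centre
    m.\<close>
  let ?L = "zigzag (m + 1) [0..<m] @ [m]"
  have "set ?L = {..<2 * m + 1}"
  proof (intro set_eqI)
    fix x
    show "x \<in> set ?L \<longleftrightarrow> x \<in> {..<2 * m + 1}"
      by auto
  qed
  then show ?thesis
    using assms True
    by (intro exI[of _ ?L]) (auto simp: forced_def successively_append_iff hd_append)
next
  case False
  \<comment> \<open>Take the zigzag for v = 0, move its consecutive entries m + v and v to the front
    in reverse order, and close the gap by the move from v - 1 to m + v + 1.\<close>
  let ?A = "zigzag (m + 1) [0..<v - 1]" and ?B = "zigzag (m + 1) [Suc v..<m]"
  let ?L = "[v, m + v] @ ?A @ [v - 1, m + v + 1] @ ?B @ [m]"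
  have "successively (forced (2 * m + 1)) ?L"
    using assms False by (auto simp: successively_append_iff successively_Cons forced_def hd_append)
  moreover have "set ?L = {..<2 * m + 1}"
  proof (intro set_eqI)
    fix x
    show "x \<in> set ?L \<longleftrightarrow> x \<in> {..<2 * m + 1}"
      using assms False by auto
  qed
  moreover have "length ?L = 2 * m + 1"
    using assms False by auto
  ultimately show ?thesis
    by (intro exI[of _ ?L]) auto
qed

section \<open>Call sequences under which all plays occupy the same set\<close>

section \<open>Plays\<close>

text \<open>Only the set of positions is recorded: different plays of the same calls may reach the
  vertices in different orders, and uniqueness of visits follows by counting.\<close>

definition covers :: "('a, 'b) pre_digraph \<Rightarrow> 'a \<Rightarrow> nat list \<Rightarrow> 'a set \<Rightarrow> bool" where
  "covers G v S A \<longleftrightarrow> nonadaptive_strategy G v S \<and> (\<forall>ps. play G v S ps \<longrightarrow> set ps = A)"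

inductive_cases play_NilE: "play G v [] ps"
inductive_cases play_ConsE: "play G v (d # S) ps"

lemma length_play: "play G v S ps \<Longrightarrow> length ps = Suc (length S)"
  by (induction rule: play.induct) auto

lemma play_not_Nil: "play G v S ps \<Longrightarrow> ps \<noteq> []"
  by (erule play.cases) auto

lemma covers_Nil: "covers G v [] {v}"
  by (auto simp: covers_def nonadaptive_strategy_def elim: play_NilE)

text \<open>The Director may have a real choice here, provided that the same remaining calls
  \<open>S\<close> cover the same set \<open>A\<close> from every possible target.\<close>

lemma covers_Cons:
  assumes "\<exists>w. at_distance G d v w" and "\<And>w. at_distance G d v w \<Longrightarrow> covers G w S A"
  shows "covers G v (d # S) (insert v A)"
  unfolding covers_def
proof (intro conjI allI impI)
  show "nonadaptive_strategy G v (d # S)"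
    unfolding nonadaptive_strategy_def
  proof (intro allI impI)
    fix i ps
    assume i: "i < length (d # S)" and play: "play G v (take i (d # S)) ps"
    show "\<exists>w. at_distance G ((d # S) ! i) (last ps) w"
    proof (cases i)
      case 0
      with play have "ps = [v]"
        by (auto elim: play_NilE)
      with 0 assms(1) show ?thesis
        by simp
    next
      case (Suc k)
      with play obtain w qs
        where "at_distance G d v w" "play G w (take k S) qs" "ps = v # qs"
        by (auto elim: play_ConsE)
      with assms(2)[of w] i Suc play_not_Nil[of G w "take k S" qs] show ?thesis
        by (auto simp: covers_def nonadaptive_strategy_def)
    qed
  qed
next
  fix ps
  assume "play G v (d # S) ps"
  then show "set ps = insert v A"
    using assms(2) by (auto simp: covers_def elim!: play_ConsE)
qed

text \<open>A list with as many entries as it has different values has no repetitions.\<close>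

lemma covers_verts_visits_each_vertex_once:
  assumes "covers G v S (verts G)" and "Suc (length S) = card (verts G)"
  shows "visits_each_vertex_once G v S"
  unfolding visits_each_vertex_once_def
proof (intro allI impI ballI)
  fix ps x
  assume play: "play G v S ps" and x: "x \<in> verts G"
  have ps: "set ps = verts G" "length ps = card (verts G)"
    using assms play length_play[OF play] by (auto simp: covers_def)
  then have "distinct ps"
    by (simp add: card_distinct)
  then show "count_list ps x = 1"
    using x ps(1) by (simp add: distinct_count_atmost_1 flip: count_mset)
qed

section \<open>Distances along a path in terms of indices\<close>

section \<open>Path graphs\<close>

locale path_listing = wf_digraph G for G :: "('a, 'b) pre_digraph" +
  fixes xs :: "'a list"
  assumes distinct_xs: "distinct xs"
    and set_xs: "set xs = verts G"
    and adjacent_iff: "\<And>i j. i < length xs \<Longrightarrow> j < length xs \<Longrightarrow>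
           xs ! i \<rightarrow>\<^bsub>G\<^esub> xs ! j \<longleftrightarrow> j = Suc i \<or> i = Suc j"
begin

lemma path_listing_rev: "path_listing G (rev xs)"
proof unfold_locales
  fix i j
  assume "i < length (rev xs)" "j < length (rev xs)"
  then show "rev xs ! i \<rightarrow>\<^bsub>G\<^esub> rev xs ! j \<longleftrightarrow> j = Suc i \<or> i = Suc j"
    by (auto simp: rev_nth adjacent_iff)
qed (use distinct_xs set_xs in auto)

text \<open>Each arc changes the index by exactly one.\<close>

lemma awalk_length_ge:
  assumes "awalk (xs ! i) p (xs ! j)" "i < length xs" "j < length xs"
  shows "i \<le> j + length p \<and> j \<le> i + length p"
  using assms
proof (induction p arbitrary: i)
  case Nil
  then show ?case
    using distinct_xs by (auto simp: awalk_Nil_iff nth_eq_iff_index_eq)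
next
  case (Cons e p)
  then have e: "e \<in> arcs G" "tail G e = xs ! i" "awalk (head G e) p (xs ! j)"
    by (auto simp: awalk_Cons_iff)
  then obtain k where k: "k < length xs" "head G e = xs ! k"
    by (metis head_in_verts in_set_conv_nth set_xs)
  have "xs ! i \<rightarrow>\<^bsub>G\<^esub> xs ! k"
    using e(1) e(2) k(2) by (metis in_arcs_imp_in_arcs_ends)
  then have "k = Suc i \<or> i = Suc k"
    using adjacent_iff Cons.prems k by blast
  then show ?case
    using Cons.IH[of k] e k Cons.prems by auto
qed

lemma awalk_upwards:
  assumes "i + d < length xs"
  shows "\<exists>p. awalk (xs ! i) p (xs ! (i + d)) \<and> length p = d"
  using assms
proof (induction d arbitrary: i)
  case 0
  then show ?case
    using set_xs by (intro exI[of _ "[]"]) (auto simp: awalk_Nil_iff)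
next
  case (Suc d)
  then obtain p where p: "awalk (xs ! Suc i) p (xs ! (i + Suc d))" "length p = d"
    by (metis add_Suc add_Suc_right)
  have "xs ! i \<rightarrow>\<^bsub>G\<^esub> xs ! Suc i"
    using Suc.prems adjacent_iff by auto
  then obtain e where e: "e \<in> arcs G" "tail G e = xs ! i" "head G e = xs ! Suc i"
    by auto
  with p show ?case
    by (intro exI[of _ "e # p"]) (auto simp: awalk_Cons_iff)
qed

lemma awalk_between:
  assumes "i < length xs" "j < length xs"
  shows "\<exists>p. awalk (xs ! i) p (xs ! j) \<and> length p = (i - j) + (j - i)"
proof (cases "i \<le> j")
  case True
  then show ?thesis
    using awalk_upwards[of i "j - i"] assms by auto
next
  case False
  \<comment> \<open>Descending walks are ascending ones in the reversed listing.\<close>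
  interpret R: path_listing G "rev xs"
    by (rule path_listing_rev)
  have "rev xs ! (length xs - Suc i) = xs ! i" "rev xs ! (length xs - Suc j) = xs ! j"
    using assms by (auto simp: rev_nth)
  then show ?thesis
    using R.awalk_upwards[of "length xs - Suc i" "i - j"] False assms by auto
qed

text \<open>With truncated subtraction, \<open>(i - j) + (j - i)\<close> is the absolute
  difference.\<close>

lemma \<mu>_eq:
  assumes "i < length xs" "j < length xs"
  shows "\<mu> (\<lambda>_. 1) (xs ! i) (xs ! j) = ereal (real ((i - j) + (j - i)))"
proof -
  have cost: "awalk_cost (\<lambda>_. 1) p = real (length p)" for p :: "'b list"
    by (induction p) auto
  obtain p where p: "awalk (xs ! i) p (xs ! j)" "length p = (i - j) + (j - i)"
    using awalk_between assms by blast
  show ?thesis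
  proof (rule antisym)
    show "\<mu> (\<lambda>_. 1) (xs ! i) (xs ! j) \<le> ereal (real ((i - j) + (j - i)))"
      using min_cost_le_walk_cost[OF p(1), of "\<lambda>_. 1"] p(2) by (simp add: cost)
    show "ereal (real ((i - j) + (j - i))) \<le> \<mu> (\<lambda>_. 1) (xs ! i) (xs ! j)"
      unfolding \<mu>_def
    proof (rule INF_greatest)
      fix q
      assume "q \<in> {q. awalk (xs ! i) q (xs ! j)}"
      then have "i \<le> j + length q \<and> j \<le> i + length q"
        using awalk_length_ge assms by blast
      then have "(i - j) + (j - i) \<le> length q"
        by linarith
      then show "ereal (real ((i - j) + (j - i))) \<le> ereal (awalk_cost (\<lambda>_. 1) q)"
        unfolding cost by (metis ereal_less_eq(3) of_nat_le_iff)
    qed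
  qed
qed

lemma at_distance_iff:
  assumes "i < length xs"
  shows "at_distance G d (xs ! i) w \<longleftrightarrow>
           (\<exists>j<length xs. w = xs ! j \<and> (j = i + d \<or> i = j + d))"
proof
  assume d: "at_distance G d (xs ! i) w"
  have "w \<in> verts G"
  \<comment> \<open>An unreachable target has infinite distance.\<close>
  proof (rule ccontr)
    assume "w \<notin> verts G"
    then have "\<not> (xs ! i \<rightarrow>\<^sup>*\<^bsub>G\<^esub> w)"
      by (metis reachable_in_vertsE)
    with d show False
      using shortest_path_inf by (simp add: at_distance_def)
  qed
  then obtain j where j: "j < length xs" "w = xs ! j"
    by (metis in_set_conv_nth set_xs)
  with d show "\<exists>j<length xs. w = xs ! j \<and> (j = i + d \<or> i = j + d)"
    using assms \<mu>_eq[of i j] by (intro exI[of _ j]) (auto simp: at_distance_def)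
next
  assume "\<exists>j<length xs. w = xs ! j \<and> (j = i + d \<or> i = j + d)"
  then show "at_distance G d (xs ! i) w"
    using assms by (auto simp: at_distance_def \<mu>_eq)
qed

text \<open>The only other candidate at this distance is the mirror image 2i - j, which forcedness
  places outside the path.\<close>

lemma forced_move:
  assumes "forced (length xs) i j"
  shows "at_distance G ((i - j) + (j - i)) (xs ! i) w \<longleftrightarrow> w = xs ! j"
  using assms
  by (subst at_distance_iff) (auto simp: forced_def intro!: arg_cong[of _ _ "(!) xs"])

end

section \<open>From forced paths to strategies\<close>

fun calls :: "nat list \<Rightarrow> nat list" where
  "calls (i # j # L) = ((i - j) + (j - i)) # calls (j # L)"
| "calls _ = []"

lemma length_calls [simp]: "length (calls L) = length L - 1"
  by (induction L rule: calls.induct) auto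

context path_listing
begin

lemma forced_path_covers:
  assumes "L \<noteq> []" "successively (forced (length xs)) L"
  shows "covers G (xs ! hd L) (calls L) ((!) xs ` set L)"
  using assms
proof (induction L rule: calls.induct)
  case (1 i j L)
  have "covers G (xs ! i) (((i - j) + (j - i)) # calls (j # L))
          (insert (xs ! i) ((!) xs ` set (j # L)))"
    using 1 by (intro covers_Cons) (auto simp: forced_move)
  then show ?case
    by simp
qed (auto simp: covers_Nil)

lemma nth_image_lessThan: "(!) xs ` {..<length xs} = verts G"
  using set_xs by (auto simp: set_conv_nth)

lemma card_verts: "card (verts G) = length xs"
  using distinct_xs set_xs distinct_card by metis

text \<open>The hypothesis puts \<open>k\<close> strictly before the centre, which gives
  \<open>k < m\<close> for either parity of the length.\<close>

lemma lower_half_strategy: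
  assumes "2 * k + 1 < length xs"
  shows "\<exists>S. covers G (xs ! k) S (verts G) \<and> Suc (length S) = length xs"
proof -
  obtain m where m: "length xs = 2 * m \<or> length xs = 2 * m + 1"
    by (meson oddE evenE)
  then have "k < m"
    using assms by auto
  then obtain L where L: "L \<noteq> []" "hd L = k" "successively (forced (length xs)) L"
      "set L = {..<length xs}" "length L = length xs"
    using m forced_path_even[of k m] forced_path_odd[of k m] by metis
  then show ?thesis
    using forced_path_covers[of L] nth_image_lessThan assms by (intro exI[of _ "calls L"]) auto
qed

text \<open>Reflection preserves distances and fixes the centre, so the calls that force a tour of
  the other vertices from one end do so from the other end too.\<close>

lemma centre_strategy:
  assumes "length xs = 2 * m + 1"
  shows "\<exists>S. covers G (xs ! m) S (verts G) \<and> Suc (length S) = length xs"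
proof (cases "m = 0")
  case True
  then show ?thesis
    using assms forced_path_covers[of "[0]"] nth_image_lessThan
    by (intro exI[of _ "[]"]) (auto simp: lessThan_Suc)
next
  case False
  \<comment> \<open>This is the odd zigzag from index 0 without the centre, which the token has
    already occupied.\<close>
  let ?L = "zigzag (m + 1) [0..<m]"
  interpret R: path_listing G "rev xs"
    by (rule path_listing_rev)
  have set_L: "set ?L = {..<length xs} - {m}"
  proof (intro set_eqI)
    fix x
    show "x \<in> set ?L \<longleftrightarrow> x \<in> {..<length xs} - {m}"
      using assms by auto
  qed
  have L: "?L \<noteq> []" "hd ?L = 0" "successively (forced (length xs)) ?L"
    using assms False by (auto simp: forced_def)
  \<comment> \<open>Stated for any listing of the same length, as it is needed for \<open>xs\<close>
    and for \<open>rev xs\<close>.\<close>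
  have minus: "(!) ys ` ({..<length xs} - {m}) = verts G - {ys ! m}"
    if "path_listing G ys" "length ys = length xs" for ys
  proof -
    interpret Y: path_listing G ys by fact
    have "inj_on ((!) ys) {..<length ys}"
      using Y.distinct_xs by (auto simp: inj_on_def nth_eq_iff_index_eq)
    then have "(!) ys ` ({..<length ys} - {m}) = (!) ys ` {..<length ys} - (!) ys ` {m}"
      using assms that by (intro inj_on_image_set_diff[of _ "{..<length ys}"]) auto
    then show ?thesis
      using that Y.nth_image_lessThan by simp
  qed
  have mid: "rev xs ! m = xs ! m"
    using assms by (simp add: rev_nth)
  have ends: "rev xs ! 0 = xs ! (2 * m)"
    using assms by (simp add: rev_nth)
  have "covers G (xs ! 0) (calls ?L) (verts G - {xs ! m})"
    using forced_path_covers[of ?L] L set_L minus[OF path_listing_axioms] by metis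
  moreover have "covers G (xs ! (2 * m)) (calls ?L) (verts G - {xs ! m})"
    using R.forced_path_covers[of ?L] L set_L minus[OF path_listing_rev] mid ends
    by (metis length_rev)
  moreover have "at_distance G m (xs ! m) w \<longleftrightarrow> w = xs ! 0 \<or> w = xs ! (2 * m)" for w
    using assms by (subst at_distance_iff) (auto simp: mult_2)
  ultimately have "covers G (xs ! m) (m # calls ?L) (insert (xs ! m) (verts G - {xs ! m}))"
    by (intro covers_Cons) auto
  moreover have "xs ! m \<in> verts G"
    using assms set_xs nth_mem[of m xs] by simp
  ultimately show ?thesis
    using assms False by (intro exI[of _ "m # calls ?L"]) (auto simp: insert_absorb)
qed

lemma ex_strategy:
  assumes "v \<in> verts G"
  shows "\<exists>S. covers G v S (verts G) \<and> Suc (length S) = card (verts G)"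
proof -
  interpret R: path_listing G "rev xs"
    by (rule path_listing_rev)
  obtain k where k: "k < length xs" "v = xs ! k"
    using assms by (metis in_set_conv_nth set_xs)
  then have k_rev: "v = rev xs ! (length xs - Suc k)"
    by (simp add: rev_nth)
  consider "2 * k + 1 < length xs" | "length xs = 2 * k + 1" | "length xs < 2 * k + 1"
    by linarith
  then show ?thesis
  proof cases
    case 1
    then show ?thesis
      using lower_half_strategy k card_verts by simp
  next
    case 2
    then show ?thesis
      using centre_strategy k card_verts by simp
  next
    case 3
    then show ?thesis
      \<comment> \<open>Beyond the centre, \<open>v\<close> lies in the lower half of the reversed
        listing.\<close>
      using R.lower_half_strategy[of "length xs - Suc k"] k k_rev card_verts by simp
  qed
qed

end

theorem theorem4p4:
  fixes G :: "('a, 'b) pre_digraph" and v :: 'a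
  assumes "path_graph G" and "v \<in> verts G"
  shows "\<exists>S. nonadaptive_strategy G v S \<and> visits_each_vertex_once G v S"
proof -
  obtain xs where "graph G" "distinct xs" "set xs = verts G"
    and adj: "\<forall>i<length xs. \<forall>j<length xs. xs ! i \<rightarrow>\<^bsub>G\<^esub> xs ! j \<longleftrightarrow> j = Suc i \<or> i = Suc j"
    using assms(1) unfolding path_graph_def by blast
  interpret graph G by fact
  interpret path_listing G xs
    by unfold_locales (use \<open>distinct xs\<close> \<open>set xs = verts G\<close> adj in auto)
  show ?thesis
    using ex_strategy[OF assms(2)] covers_verts_visits_each_vertex_once[of G v]
    unfolding covers_def by blast
qed

end
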